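(* Let $K$ be a differential field, let $n\ge 1$, and let $y^{(n)}+a_1y^{(n-1)}+\dots+a_ny=0$ be a homogeneous linear differential equation with coefficients $a_1,\dots,a_n\in K$. Suppose the equation is solvable by admissible extensions, i.e. there is an admissible extension $E$ of $K$ which contains all solutions of the equation. Then there is a chain of differential fields $K=K_0\subset K_1\subset\dots\subset K_m$ such that $K_m$ contains all solutions of the equation and such that, for each $0\le i<m$, $K_{i+1}=K_i\langle y_i\rangle$ where $y_i$ is either an integral over $K_i$ (i.e. $y_i'\in K_i$), or an exponential of an integral over $K_i$ that is transcendental over $K_i$ (i.e. $y_i\neq 0$, $y_i'=b_iy_i$ with $b_i\in K_i$, and $y_i$ is transcendental over $K_i$).
   Context: A differential field is a field with an additive map $a\mapsto a'$ satisfying $(ab)'=a'b+ab'$. A constant is an element $c$ with $c'=0$. Throughout, all differential fields have characteristic $0$ and all have the same fixed field of constants (so no extension of differential fields contains new constants). $K\langle y\rangle$ denotes the smallest differential field containing $K$ and $y$ (inside a given differential extension of $K$). An element $y$ of a differential extension of $K$ is a special transcendental element over $K$ if $y$ is transcendental over $K$ and $y'=\mathcal R(y)$, where $\mathcal R$ is a rational function over $K$ representable in the form $\mathcal R=\frac{yP}{Q}$ with $P,Q\in K[y]$ and the polynomials $yP$ and $Q$ relatively prime. An extension $K\subset E$ of differential fields is admissible if there is a chain of differential fields $K=K_0\subset\dots\subset K_r=E$ such that each $K_{i+1}$ is obtained from $K_i$ by adjoining a special transcendental element over $K_i$. A differential field "contains all solutions" of a homogeneous linear equation of order $n$ if it contains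 $n$ solutions that are linearly independent over the field of constants. *)

theory Defs
  imports "HOL-Computational_Algebra.Polynomial"
begin

text \<open>
  All differential fields of the development are subfields, closed under \<open>D\<close>, of one arbitrary
  field \<open>'a\<close> of characteristic 0 with a derivation \<open>D\<close>. Nothing is assumed about the constants
  of \<open>'a\<close> itself; the convention that extensions have no new constants is part of \<open>diff_extension\<close>.
\<close>

definition derivation :: "('a::field_char_0 \<Rightarrow> 'a) \<Rightarrow> bool" where
  "derivation D \<longleftrightarrow>
     (\<forall>x y. D (x + y) = D x + D y) \<and> (\<forall>x y. D (x * y) = D x * y + x * D y)"

definition diff_subfield :: "('a::field_char_0 \<Rightarrow> 'a) \<Rightarrow> 'a set \<Rightarrow> bool" where
  "diff_subfield D K \<longleftrightarrow>
     0 \<in> K \<and> 1 \<in> K \<and>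
     (\<forall>x\<in>K. \<forall>y\<in>K. x + y \<in> K \<and> x * y \<in> K) \<and>
     (\<forall>x\<in>K. - x \<in> K \<and> inverse x \<in> K \<and> D x \<in> K)"

definition constants :: "('a::field_char_0 \<Rightarrow> 'a) \<Rightarrow> 'a set \<Rightarrow> 'a set" where
  "constants D K = {c \<in> K. D c = 0}"

definition diff_extension :: "('a::field_char_0 \<Rightarrow> 'a) \<Rightarrow> 'a set \<Rightarrow> 'a set \<Rightarrow> bool" where
  "diff_extension D K F \<longleftrightarrow>
     diff_subfield D K \<and> diff_subfield D F \<and> K \<subseteq> F \<and> constants D F = constants D K"

definition diff_adjoin :: "('a::field_char_0 \<Rightarrow> 'a) \<Rightarrow> 'a set \<Rightarrow> 'a \<Rightarrow> 'a set" where
  "diff_adjoin D K y = \<Inter>{F. diff_subfield D F \<and> K \<subseteq> F \<and> y \<in> F}"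

definition polys_over :: "'a::field_char_0 set \<Rightarrow> 'a poly set" where
  "polys_over K = {p. \<forall>i. coeff p i \<in> K}"

definition transcendental_over :: "'a::field_char_0 set \<Rightarrow> 'a \<Rightarrow> bool" where
  "transcendental_over K y \<longleftrightarrow> (\<forall>p\<in>polys_over K. p \<noteq> 0 \<longrightarrow> poly p y \<noteq> 0)"

text \<open>
  Relative primality in the ring \<open>K[y]\<close>: common divisors, with both cofactors, are taken in
  \<open>K[y]\<close>. A unit of \<open>'a[y]\<close> with coefficients in the field \<open>K\<close> is a unit of \<open>K[y]\<close>.
\<close>

definition relatively_prime_over :: "'a::field_char_0 set \<Rightarrow> 'a poly \<Rightarrow> 'a poly \<Rightarrow> bool" where
  "relatively_prime_over K p q \<longleftrightarrow>
     (\<forall>d\<in>polys_over K. \<forall>u\<in>polys_over K. \<forall>v\<in>polys_over K.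
        p = d * u \<and> q = d * v \<longrightarrow> is_unit d)"

text \<open>
  The polynomial \<open>[:0, 1:]\<close> is the indeterminate. Relative primality forces \<open>Q \<noteq> 0\<close>, hence
  \<open>poly Q y \<noteq> 0\<close> by transcendence, so the quotient is a genuine one.
\<close>

definition special_transcendental :: "('a::field_char_0 \<Rightarrow> 'a) \<Rightarrow> 'a set \<Rightarrow> 'a \<Rightarrow> bool" where
  "special_transcendental D K y \<longleftrightarrow>
     transcendental_over K y \<and>
     (\<exists>P\<in>polys_over K. \<exists>Q\<in>polys_over K.
        relatively_prime_over K ([:0, 1:] * P) Q \<and>
        D y = poly ([:0, 1:] * P) y / poly Q y)"

text \<open>
  A chain \<open>Ks 0 \<subseteq> \<dots> \<subseteq> Ks m\<close>; the values \<open>Ks i\<close> with \<open>i > m\<close> are irrelevant. The first conjunct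
  matters only for \<open>m = 0\<close>.
\<close>

definition diff_chain :: "('a::field_char_0 \<Rightarrow> 'a) \<Rightarrow> nat \<Rightarrow> (nat \<Rightarrow> 'a set) \<Rightarrow> bool" where
  "diff_chain D m Ks \<longleftrightarrow>
     diff_subfield D (Ks 0) \<and> (\<forall>i<m. diff_extension D (Ks i) (Ks (Suc i)))"

definition admissible_extension :: "('a::field_char_0 \<Rightarrow> 'a) \<Rightarrow> 'a set \<Rightarrow> 'a set \<Rightarrow> bool" where
  "admissible_extension D K E \<longleftrightarrow>
     (\<exists>r Ks. diff_chain D r Ks \<and> Ks 0 = K \<and> Ks r = E \<and>
        (\<forall>i<r. \<exists>y. special_transcendental D (Ks i) y \<and> Ks (Suc i) = diff_adjoin D (Ks i) y))"

definition is_solution ::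
    "('a::field_char_0 \<Rightarrow> 'a) \<Rightarrow> nat \<Rightarrow> (nat \<Rightarrow> 'a) \<Rightarrow> 'a \<Rightarrow> bool" where
  "is_solution D n a y \<longleftrightarrow> (D ^^ n) y + (\<Sum>i=1..n. a i * (D ^^ (n - i)) y) = 0"

definition contains_all_solutions ::
    "('a::field_char_0 \<Rightarrow> 'a) \<Rightarrow> 'a set \<Rightarrow> nat \<Rightarrow> (nat \<Rightarrow> 'a) \<Rightarrow> bool" where
  "contains_all_solutions D F n a \<longleftrightarrow>
     (\<exists>y. (\<forall>i<n. y i \<in> F \<and> is_solution D n a (y i)) \<and>
        (\<forall>c. (\<forall>i<n. c i \<in> constants D F) \<and> (\<Sum>i<n. c i * y i) = 0 \<longrightarrow> (\<forall>i<n. c i = 0)))"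

definition integral_over :: "('a::field_char_0 \<Rightarrow> 'a) \<Rightarrow> 'a set \<Rightarrow> 'a \<Rightarrow> bool" where
  "integral_over D K y \<longleftrightarrow> D y \<in> K"

definition exp_integral_over :: "('a::field_char_0 \<Rightarrow> 'a) \<Rightarrow> 'a set \<Rightarrow> 'a \<Rightarrow> bool" where
  "exp_integral_over D K y \<longleftrightarrow> y \<noteq> 0 \<and> (\<exists>b\<in>K. D y = b * y)"

end

theory Submission
  imports Defs
begin

text \<open>
  For a special transcendental \<open>y\<close> over \<open>K\<close>, setting \<open>y = 0\<close> is a differential homomorphism onto
  \<open>K\<close> from the valuation ring of \<open>y = 0\<close> in \<open>K(y)\<close>. Solutions of a Riccati equation over \<open>K\<close> have no
  pole there, so they specialize; going down the admissible tower, the logarithmic derivative of a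
  solution of \<open>L\<close> in \<open>E\<close> yields \<open>b \<in> K\<close> with \<open>L = M (D - b)\<close>. As there are no new constants, the
  kernel of \<open>D - b\<close> on the solution space is spanned by some \<open>w \<noteq> 0\<close>, and the image is the full
  solution space of \<open>M\<close> in \<open>E\<close>, so that \<open>L\<close> is solved by iterating \<open>y = w \<integral> z / w\<close>.

  All exponentials \<open>w\<close> needed have \<open>w' / w\<close> in the base field \<open>K\<close>. The order at \<open>y = 0\<close> shows that,
  at each step of the tower, the group of these \<open>w\<close> grows by at most one generator, of nonzero
  order and therefore transcendental. Adjoining these generators first avoids algebraic extensions.
\<close>

section \<open>Closure properties of differential subfields and of polynomials over them\<close>

lemma diff_subfieldD:
  assumes "diff_subfield D K"
  shows "0 \<in> K" "1 \<in> K"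
    "\<And>x y. x \<in> K \<Longrightarrow> y \<in> K \<Longrightarrow> x + y \<in> K" "\<And>x y. x \<in> K \<Longrightarrow> y \<in> K \<Longrightarrow> x * y \<in> K"
    "\<And>x. x \<in> K \<Longrightarrow> - x \<in> K" "\<And>x. x \<in> K \<Longrightarrow> inverse x \<in> K" "\<And>x. x \<in> K \<Longrightarrow> D x \<in> K"
    "\<And>x y. x \<in> K \<Longrightarrow> y \<in> K \<Longrightarrow> x - y \<in> K" "\<And>x y. x \<in> K \<Longrightarrow> y \<in> K \<Longrightarrow> x / y \<in> K"
proof -
  show *: "0 \<in> K" "1 \<in> K"
    "\<And>x y. x \<in> K \<Longrightarrow> y \<in> K \<Longrightarrow> x + y \<in> K" "\<And>x y. x \<in> K \<Longrightarrow> y \<in> K \<Longrightarrow> x * y \<in> K"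
    "\<And>x. x \<in> K \<Longrightarrow> - x \<in> K" "\<And>x. x \<in> K \<Longrightarrow> inverse x \<in> K" "\<And>x. x \<in> K \<Longrightarrow> D x \<in> K"
    using assms unfolding diff_subfield_def by auto
  show "x - y \<in> K" if "x \<in> K" "y \<in> K" for x y
    using *(3)[OF that(1) *(5)[OF that(2)]] by simp
  show "x / y \<in> K" if "x \<in> K" "y \<in> K" for x y
    using *(4)[OF that(1) *(6)[OF that(2)]] by (simp add: divide_inverse)
qed

lemma diff_subfield_sum:
  assumes "diff_subfield D K" "\<And>i. i \<in> I \<Longrightarrow> f i \<in> K"
  shows "(\<Sum>i\<in>I. f i) \<in> K"
  using assms(2) by (induction I rule: infinite_finite_induct) (auto intro: diff_subfieldD[OF assms(1)])

lemma diff_subfield_of_nat: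
  assumes "diff_subfield D K"
  shows "of_nat n \<in> K"
  by (induction n) (auto intro: diff_subfieldD[OF assms])

lemma diff_subfield_power:
  assumes "diff_subfield D K" "x \<in> K"
  shows "x ^ n \<in> K"
  by (induction n) (auto intro: diff_subfieldD[OF assms(1)] assms(2))

lemma diff_subfield_power_int:
  assumes "diff_subfield D K" "x \<in> K"
  shows "x powi n \<in> K"
  unfolding power_int_def
  by (auto intro!: diff_subfield_power[OF assms(1)] diff_subfieldD[OF assms(1)] assms(2))

lemma diff_adjoin_subset:
  assumes "diff_subfield D F" "K \<subseteq> F" "y \<in> F"
  shows "diff_adjoin D K y \<subseteq> F"
  using assms unfolding diff_adjoin_def by blast

lemma diff_adjoin_base: "K \<subseteq> diff_adjoin D K y"
  and diff_adjoin_generator: "y \<in> diff_adjoin D K y"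
  and diff_subfield_adjoin: "diff_subfield D (diff_adjoin D K y)"
  unfolding diff_adjoin_def diff_subfield_def by auto

lemma pCons_polys_over_iff: "pCons a p \<in> polys_over K \<longleftrightarrow> a \<in> K \<and> p \<in> polys_over K"
proof
  assume *: "pCons a p \<in> polys_over K"
  have "coeff (pCons a p) 0 \<in> K" "\<And>i. coeff (pCons a p) (Suc i) \<in> K"
    using * unfolding polys_over_def by blast+
  then show "a \<in> K \<and> p \<in> polys_over K"
    by (auto simp: polys_over_def)
qed (auto simp: polys_over_def coeff_pCons split: nat.split)

lemma polys_over_closed:
  assumes "diff_subfield D K"
  shows "0 \<in> polys_over K" "1 \<in> polys_over K"
    "p \<in> polys_over K \<Longrightarrow> q \<in> polys_over K \<Longrightarrow> p + q \<in> polys_over K"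
    "p \<in> polys_over K \<Longrightarrow> q \<in> polys_over K \<Longrightarrow> p * q \<in> polys_over K"
    "p \<in> polys_over K \<Longrightarrow> - p \<in> polys_over K"
    "p \<in> polys_over K \<Longrightarrow> pderiv p \<in> polys_over K"
    "p \<in> polys_over K \<Longrightarrow> D 0 = 0 \<Longrightarrow> map_poly D p \<in> polys_over K"
  unfolding polys_over_def
  by (auto simp: coeff_mult coeff_pderiv coeff_map_poly coeff_1
      intro!: diff_subfieldD[OF assms] diff_subfield_sum[OF assms] diff_subfield_of_nat[OF assms]
      simp del: of_nat_Suc)

text \<open>Induction on the coefficients: a zero constant term contributes one factor
  \<open>x\<close>. The identity holds for all \<open>x\<close> because it is evaluated both at a
  generator \<open>y\<close> and at other elements.\<close>

lemma poly_split_power: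
  assumes "p \<in> polys_over K" "p \<noteq> 0"
  shows "\<exists>m. \<exists>q\<in>polys_over K. poly q 0 \<noteq> 0 \<and> (\<forall>x. poly p x = x ^ m * poly q x)"
  using assms
proof (induction p)
  case (pCons a p)
  show ?case
  proof (cases "a = 0")
    case True
    then obtain m q where *: "q \<in> polys_over K" "poly q 0 \<noteq> 0" "\<forall>x. poly p x = x ^ m * poly q x"
      using pCons by (auto simp: pCons_polys_over_iff)
    then have "\<forall>x. poly (pCons a p) x = x ^ Suc m * poly q x"
      using True by simp
    with * show ?thesis by blast
  next
    case False
    then show ?thesis
      using pCons.prems by (intro exI[of _ 0] bexI[of _ "pCons a p"]) auto
  qed
qed simp

section \<open>Calculus of derivations and exponentials of integrals\<close>

locale differential_field =
  fixes D :: "'a::field_char_0 \<Rightarrow> 'a"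
  assumes derivation: "derivation D"
begin

lemma D_add: "D (x + y) = D x + D y"
  and D_mult: "D (x * y) = D x * y + x * D y"
  using derivation unfolding derivation_def by auto

lemma D_0 [simp]: "D 0 = 0"
  using D_add[of 0 0] by simp

lemma D_1 [simp]: "D 1 = 0"
  using D_mult[of 1 1] by simp

lemma D_minus: "D (- x) = - D x"
  using D_add[of x "- x"] by (simp add: eq_neg_iff_add_eq_0 add.commute)

lemma D_diff: "D (x - y) = D x - D y"
  using D_add[of x "- y"] by (simp add: D_minus)

lemma D_sum: "D (\<Sum>i\<in>I. f i) = (\<Sum>i\<in>I. D (f i))"
  by (induction I rule: infinite_finite_induct) (auto simp: D_add)

lemma D_inverse: "D (inverse x) = - D x / x\<^sup>2"
proof (cases "x = 0")
  case False
  then have "D x * inverse x + x * D (inverse x) = 0"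
    using D_mult[of x "inverse x"] by simp
  then have "x * D (inverse x) = - (D x * inverse x)"
    by (simp add: eq_neg_iff_add_eq_0 add.commute)
  with False show ?thesis
    by (simp add: field_simps power2_eq_square)
qed simp

lemma D_divide: "D (x / y) = (D x * y - x * D y) / y\<^sup>2"
proof (cases "y = 0")
  case False
  have "D (x / y) = D x * inverse y + x * D (inverse y)"
    by (simp only: divide_inverse D_mult)
  also have "\<dots> = (D x * y - x * D y) / y\<^sup>2"
    unfolding D_inverse using False by (simp add: field_simps power2_eq_square)
  finally show ?thesis .
qed simp

lemma mult_D_power: "x * D (x ^ n) = of_nat n * D x * x ^ n"
  by (induction n) (auto simp: D_mult algebra_simps)

lemma D_poly: "D (poly p x) = poly (map_poly D p) x + poly (pderiv p) x * D x"
  by (induction p) (auto simp: map_poly_pCons D_add D_mult pderiv_pCons algebra_simps)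

text \<open>By the quotient rule. In the absence of new constants this makes the kernel of
  \<open>D - b\<close> at most one-dimensional.\<close>

lemma constant_ratio:
  assumes "D u = b * u" "D w = b * w" "w \<noteq> 0"
  shows "D (u / w) = 0"
  using assms by (simp add: D_divide)

text \<open>Logarithmic derivatives add under multiplication. With the closure under inverses below,
  exponentials of integrals over \<open>K\<close> form a multiplicative group.\<close>

lemma exp_integral_over_mult:
  assumes "diff_subfield D K" "exp_integral_over D K v" "exp_integral_over D K w"
  shows "exp_integral_over D K (v * w)"
proof -
  obtain b c where "b \<in> K" "c \<in> K" "D v = b * v" "D w = c * w" "v \<noteq> 0" "w \<noteq> 0"
    using assms unfolding exp_integral_over_def by auto
  then show ?thesis
    unfolding exp_integral_over_def
    by (intro conjI bexI[of _ "b + c"]) (auto simp: D_mult algebra_simps intro: diff_subfieldD[OF assms(1)])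
qed

lemma exp_integral_over_inverse:
  assumes "diff_subfield D K" "exp_integral_over D K w"
  shows "exp_integral_over D K (inverse w)"
proof -
  obtain b where "b \<in> K" "D w = b * w" "w \<noteq> 0"
    using assms unfolding exp_integral_over_def by auto
  then show ?thesis
    unfolding exp_integral_over_def
    by (intro conjI bexI[of _ "- b"])
      (simp_all add: D_inverse power2_eq_square divide_inverse diff_subfieldD(5)[OF assms(1)])
qed

lemma exp_integral_over_power_int:
  assumes "diff_subfield D K" "exp_integral_over D K w"
  shows "exp_integral_over D K (w powi n)"
proof -
  have "exp_integral_over D K 1"
    unfolding exp_integral_over_def using diff_subfieldD(1)[OF assms(1)] by (auto intro!: bexI[of _ 0])
  then have *: "exp_integral_over D K (v ^ m)" if "exp_integral_over D K v" for v m
    using that by (induction m) (auto intro: exp_integral_over_mult[OF assms(1)])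
  show ?thesis
    unfolding power_int_def by (auto intro: * exp_integral_over_inverse[OF assms(1)] assms(2))
qed

subsection \<open>Linear operators and their Riccati equations\<close>

definition lower_ops :: "'a set \<Rightarrow> nat \<Rightarrow> ('a \<Rightarrow> 'a) set" where
  "lower_ops K n = {L. \<exists>c. (\<forall>i. c i \<in> K) \<and> L = (\<lambda>y. \<Sum>i<n. c i * (D ^^ i) y)}"

text \<open>\<open>ric b n\<close> is \<open>w\<^sup>(\<^sup>n\<^sup>) / w\<close> for an element \<open>w\<close> with \<open>w' = b w\<close>.\<close>

primrec ric :: "'a \<Rightarrow> nat \<Rightarrow> 'a" where
  "ric b 0 = 1"
| "ric b (Suc n) = D (ric b n) + b * ric b n"

lemma ric_closed:
  assumes "diff_subfield D K" "b \<in> K"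
  shows "ric b n \<in> K"
  by (induction n) (auto intro: diff_subfieldD[OF assms(1)] assms(2))

lemma D_funpow_exp:
  assumes "D w = b * w"
  shows "(D ^^ n) w = ric b n * w"
  by (induction n) (auto simp: D_mult assms algebra_simps)

lemma lower_opsI:
  assumes "\<And>i. c i \<in> K" "\<And>y. L y = (\<Sum>i<n. c i * (D ^^ i) y)"
  shows "L \<in> lower_ops K n"
  unfolding lower_ops_def using assms by blast

lemma lower_ops_zero:
  assumes "diff_subfield D K"
  shows "(\<lambda>y. 0) \<in> lower_ops K n"
  by (rule lower_opsI[of "\<lambda>i. 0"]) (simp_all add: diff_subfieldD(1)[OF assms])

lemma lower_ops_add:
  assumes "diff_subfield D K" "L \<in> lower_ops K n" "M \<in> lower_ops K n"
  shows "(\<lambda>y. L y + M y) \<in> lower_ops K n"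
proof -
  obtain c d where "\<forall>i. c i \<in> K" "L = (\<lambda>y. \<Sum>i<n. c i * (D ^^ i) y)"
    "\<forall>i. d i \<in> K" "M = (\<lambda>y. \<Sum>i<n. d i * (D ^^ i) y)"
    using assms unfolding lower_ops_def by auto
  then show ?thesis
    by (intro lower_opsI[of "\<lambda>i. c i + d i"])
      (simp_all add: diff_subfieldD(3)[OF assms(1)] distrib_right sum.distrib)
qed

lemma lower_ops_scale:
  assumes "diff_subfield D K" "L \<in> lower_ops K n" "k \<in> K"
  shows "(\<lambda>y. k * L y) \<in> lower_ops K n"
proof -
  obtain c where "\<forall>i. c i \<in> K" "L = (\<lambda>y. \<Sum>i<n. c i * (D ^^ i) y)"
    using assms unfolding lower_ops_def by auto
  then show ?thesis
    using assms(3) by (intro lower_opsI[of "\<lambda>i. k * c i"])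
      (simp_all add: diff_subfieldD(4)[OF assms(1)] sum_distrib_left mult.assoc)
qed

lemma lower_ops_sum:
  assumes "diff_subfield D K" "\<And>i. i \<in> I \<Longrightarrow> L i \<in> lower_ops K n"
  shows "(\<lambda>y. \<Sum>i\<in>I. L i y) \<in> lower_ops K n"
  using assms(2)
  by (induction I rule: infinite_finite_induct)
    (auto intro: lower_ops_zero[OF assms(1)] lower_ops_add[OF assms(1)])

lemma lower_ops_mono:
  assumes "diff_subfield D K" "L \<in> lower_ops K m" "m \<le> n"
  shows "L \<in> lower_ops K n"
proof -
  obtain c where c: "\<forall>i. c i \<in> K" "L = (\<lambda>y. \<Sum>i<m. c i * (D ^^ i) y)"
    using assms unfolding lower_ops_def by auto
  have "(\<Sum>i<m. c i * (D ^^ i) y) = (\<Sum>i<n. (if i < m then c i else 0) * (D ^^ i) y)" for y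
    using assms(3) by (intro sum.mono_neutral_cong_left) auto
  with c show ?thesis
    by (intro lower_opsI[of "\<lambda>i. if i < m then c i else 0"]) (simp_all add: diff_subfieldD(1)[OF assms(1)])
qed

lemma lower_ops_D:
  assumes "diff_subfield D K" "L \<in> lower_ops K n"
  shows "(\<lambda>y. D (L y)) \<in> lower_ops K (Suc n)"
proof -
  obtain c where c: "\<forall>i. c i \<in> K" "L = (\<lambda>y. \<Sum>i<n. c i * (D ^^ i) y)"
    using assms unfolding lower_ops_def by auto
  have "(\<lambda>y. \<Sum>i<n. D (c i) * (D ^^ i) y) \<in> lower_ops K n"
    using c(1) by (intro lower_opsI[of "\<lambda>i. D (c i)"]) (simp_all add: diff_subfieldD(7)[OF assms(1)])
  then have 1: "(\<lambda>y. \<Sum>i<n. D (c i) * (D ^^ i) y) \<in> lower_ops K (Suc n)"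
    using lower_ops_mono[OF assms(1)] by simp
  have "(\<Sum>i<n. c i * (D ^^ Suc i) y) = (\<Sum>i<Suc n. (case i of 0 \<Rightarrow> 0 | Suc j \<Rightarrow> c j) * (D ^^ i) y)" for y
    unfolding sum.lessThan_Suc_shift by simp
  then have 2: "(\<lambda>y. \<Sum>i<n. c i * (D ^^ Suc i) y) \<in> lower_ops K (Suc n)"
    using c(1) by (intro lower_opsI[of "\<lambda>i. case i of 0 \<Rightarrow> 0 | Suc j \<Rightarrow> c j"])
      (simp_all add: diff_subfieldD(1)[OF assms(1)] split: nat.split)
  show ?thesis
    using lower_ops_add[OF assms(1) 1 2] unfolding c(2) by (simp add: D_sum D_mult sum.distrib)
qed

text \<open>Right division of \<open>D ^^ Suc n\<close> by \<open>D - b\<close>, with remainder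
  \<open>ric b (Suc n)\<close>. The induction differentiates the identity and rewrites
  \<open>D (r * y)\<close> as \<open>r * (D y - b * y) + (D r + b * r) * y\<close>, whose last
  coefficient is the next \<open>ric\<close>.\<close>

lemma funpow_right_division:
  assumes K: "diff_subfield D K" and b: "b \<in> K"
  shows "\<exists>Q\<in>lower_ops K n. \<forall>y. (D ^^ Suc n) y = (D ^^ n) (D y - b * y) + Q (D y - b * y) + ric b (Suc n) * y"
proof (induction n)
  case 0
  show ?case
    using lower_ops_zero[OF K] by (intro bexI[of _ "\<lambda>y. 0"]) auto
next
  case (Suc n)
  then obtain Q where Q: "Q \<in> lower_ops K n"
    "\<And>y. (D ^^ Suc n) y = (D ^^ n) (D y - b * y) + Q (D y - b * y) + ric b (Suc n) * y"
    by auto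
  let ?r = "ric b (Suc n)"
  let ?Q = "\<lambda>y. D (Q y) + ?r * y"
  have "(\<lambda>y. y) \<in> lower_ops K (Suc n)"
    by (rule lower_opsI[of "\<lambda>i. if i = 0 then 1 else 0"])
      (simp_all add: diff_subfieldD(1,2)[OF K] sum.lessThan_Suc_shift del: sum.lessThan_Suc)
  then have Q': "?Q \<in> lower_ops K (Suc n)"
    using lower_ops_add[OF K lower_ops_D[OF K Q(1)]] lower_ops_scale[OF K _ ric_closed[OF K b]]
    by blast
  have "(D ^^ Suc (Suc n)) y = (D ^^ Suc n) (D y - b * y) + ?Q (D y - b * y) + ric b (Suc (Suc n)) * y" for y
  proof -
    have "(D ^^ Suc (Suc n)) y = D ((D ^^ Suc n) y)" by simp
    also have "\<dots> = D ((D ^^ n) (D y - b * y)) + D (Q (D y - b * y)) + (D ?r * y + ?r * D y)"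
      unfolding Q(2) by (simp only: D_add D_mult)
    finally show ?thesis
      by (simp add: algebra_simps)
  qed
  then show ?case
    by (intro bexI[OF _ Q'] allI)
qed

definition monic_op :: "nat \<Rightarrow> (nat \<Rightarrow> 'a) \<Rightarrow> 'a \<Rightarrow> 'a" where
  "monic_op n c y = (D ^^ n) y + (\<Sum>i<n. c i * (D ^^ i) y)"

text \<open>The quotient \<open>L w / w\<close> for \<open>L = monic_op n c\<close>,
  \<open>D w = b * w\<close> and \<open>w \<noteq> 0\<close>, written in \<open>b\<close> and its
  derivatives.\<close>

definition riccati :: "nat \<Rightarrow> (nat \<Rightarrow> 'a) \<Rightarrow> 'a \<Rightarrow> 'a" where
  "riccati n c b = ric b n + (\<Sum>i<n. c i * ric b i)"

lemma monic_op_exp: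
  assumes "D w = b * w"
  shows "monic_op n c w = riccati n c b * w"
  unfolding monic_op_def riccati_def by (simp add: D_funpow_exp[OF assms] sum_distrib_left algebra_simps)

text \<open>Dividing every term of the operator by \<open>D - b\<close> leaves the total remainder
  \<open>riccati (Suc n) c b\<close>, so a solution of the Riccati equation splits off a right
  factor \<open>D - b\<close>.\<close>

lemma monic_op_right_division:
  assumes K: "diff_subfield D K" and b: "b \<in> K" and c: "\<And>i. c i \<in> K"
    and ric: "riccati (Suc n) c b = 0"
  shows "\<exists>d. (\<forall>i. d i \<in> K) \<and> (\<forall>y. monic_op (Suc n) c y = monic_op n d (D y - b * y))"
proof -
  have "\<exists>Q\<in>lower_ops K n. \<forall>y. (D ^^ i) y = Q (D y - b * y) + ric b i * y" if i: "i < Suc n" for i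
  proof (cases i)
    case 0
    then show ?thesis
      using lower_ops_zero[OF K] by (intro bexI[of _ "\<lambda>y. 0"]) auto
  next
    case (Suc j)
    obtain Q where Q: "Q \<in> lower_ops K j"
      "\<And>y. (D ^^ Suc j) y = (D ^^ j) (D y - b * y) + Q (D y - b * y) + ric b (Suc j) * y"
      using funpow_right_division[OF K b] by blast
    have "(D ^^ j) \<in> lower_ops K (Suc j)"
      by (rule lower_opsI[of "\<lambda>i. if i = j then 1 else 0"]) (simp_all add: diff_subfieldD(1,2)[OF K])
    then have "(\<lambda>y. (D ^^ j) y + Q y) \<in> lower_ops K (Suc j)"
      using lower_ops_add[OF K _ lower_ops_mono[OF K Q(1)]] by simp
    then have "(\<lambda>y. (D ^^ j) y + Q y) \<in> lower_ops K n"
      using lower_ops_mono[OF K] i Suc by simp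
    then show ?thesis
      using Q(2) Suc by (intro bexI[of _ "\<lambda>y. (D ^^ j) y + Q y"]) auto
  qed
  then obtain Q where Q: "\<And>i. i < Suc n \<Longrightarrow> Q i \<in> lower_ops K n"
    "\<And>i y. i < Suc n \<Longrightarrow> (D ^^ i) y = Q i (D y - b * y) + ric b i * y"
    by metis
  \<comment> \<open>The leading term is divided separately: the leading part \<open>D ^^ n\<close>
    of its quotient stays explicit and makes the whole quotient monic.\<close>
  obtain R where R: "R \<in> lower_ops K n"
    "\<And>y. (D ^^ Suc n) y = (D ^^ n) (D y - b * y) + R (D y - b * y) + ric b (Suc n) * y"
    using funpow_right_division[OF K b] by blast
  have "(\<lambda>y. R y + (\<Sum>i<Suc n. c i * Q i y)) \<in> lower_ops K n"
    using Q(1) c by (intro lower_ops_add[OF K R(1)] lower_ops_sum[OF K] lower_ops_scale[OF K]) auto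
  then obtain d where d: "\<forall>i. d i \<in> K" "(\<lambda>y. R y + (\<Sum>i<Suc n. c i * Q i y)) = (\<lambda>y. \<Sum>i<n. d i * (D ^^ i) y)"
    unfolding lower_ops_def by blast
  have "monic_op (Suc n) c y = monic_op n d (D y - b * y)" for y
  proof -
    let ?z = "D y - b * y"
    have "(\<Sum>i<Suc n. c i * (D ^^ i) y) = (\<Sum>i<Suc n. c i * Q i ?z + c i * ric b i * y)"
      by (intro sum.cong refl) (simp add: Q(2) algebra_simps)
    also have "\<dots> = (\<Sum>i<Suc n. c i * Q i ?z) + (\<Sum>i<Suc n. c i * ric b i) * y"
      by (simp only: sum.distrib sum_distrib_right)
    finally have "monic_op (Suc n) c y =
        (D ^^ n) ?z + (R ?z + (\<Sum>i<Suc n. c i * Q i ?z)) + riccati (Suc n) c b * y"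
      unfolding monic_op_def riccati_def R(2) by (simp only: algebra_simps)
    then show ?thesis
      using ric fun_cong[OF d(2), of ?z] unfolding monic_op_def by simp
  qed
  with d(1) show ?thesis by blast
qed

section \<open>Linear independence over the constants\<close>

lemma first_order_linear:
  assumes "\<And>i. i \<in> I \<Longrightarrow> D (d i) = 0"
  shows "D (\<Sum>i\<in>I. d i * y i) - b * (\<Sum>i\<in>I. d i * y i) = (\<Sum>i\<in>I. d i * (D (y i) - b * y i))"
  using assms by (simp add: D_sum D_mult sum_distrib_left sum_subtractf[symmetric] algebra_simps)

text \<open>Indexed by an arbitrary set, so that inductions on the order can remove one index
  without renumbering.\<close>

definition const_independent :: "'a set \<Rightarrow> nat set \<Rightarrow> (nat \<Rightarrow> 'a) \<Rightarrow> bool" where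
  "const_independent E I y \<longleftrightarrow>
     (\<forall>c. (\<forall>i\<in>I. c i \<in> constants D E) \<and> (\<Sum>i\<in>I. c i * y i) = 0 \<longrightarrow> (\<forall>i\<in>I. c i = 0))"

lemma const_independent_nonzero:
  assumes E: "diff_subfield D E" and "const_independent E I y" "finite I" "j \<in> I"
  shows "y j \<noteq> 0"
proof
  assume "y j = 0"
  define c :: "nat \<Rightarrow> 'a" where "c = (\<lambda>i. if i = j then 1 else 0)"
  have "(\<Sum>i\<in>I. c i * y i) = 0"
    unfolding c_def using \<open>y j = 0\<close> by (intro sum.neutral) auto
  moreover have "\<forall>i\<in>I. c i \<in> constants D E"
    unfolding constants_def c_def using diff_subfieldD(1,2)[OF E] by auto
  ultimately have "\<forall>i\<in>I. c i = 0"
    using assms(2) unfolding const_independent_def by blast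
  with assms(4) show False by (auto simp: c_def)
qed

text \<open>If a combination of the \<open>y i\<close> that involves \<open>y j\<close> spans the kernel of \<open>D - b\<close>, applying
  \<open>D - b\<close> keeps the other elements independent.\<close>

lemma const_independent_reduce:
  assumes E: "diff_subfield D E" and ind: "const_independent E I y" and I: "finite I" "j \<in> I"
    and c: "\<And>i. i \<in> I \<Longrightarrow> c i \<in> constants D E" "c j \<noteq> 0"
    and w: "w = (\<Sum>i\<in>I. c i * y i)" "w \<noteq> 0" "D w = b * w" and yE: "\<And>i. i \<in> I \<Longrightarrow> y i \<in> E"
  shows "const_independent E (I - {j}) (\<lambda>i. D (y i) - b * y i)"
  unfolding const_independent_def
proof (intro allI impI)
  fix d assume d: "(\<forall>i\<in>I - {j}. d i \<in> constants D E) \<and> (\<Sum>i\<in>I - {j}. d i * (D (y i) - b * y i)) = 0"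
  define u where "u = (\<Sum>i\<in>I - {j}. d i * y i)"
  \<comment> \<open>\<open>u\<close> turns out to be a constant multiple of \<open>w\<close>.
    Writing \<open>u - u / w * w = 0\<close> in terms of the \<open>y i\<close> gives a relation
    with coefficients \<open>e i\<close>; at \<open>i = j\<close> it forces
    \<open>u / w = 0\<close>, and then all \<open>d i\<close> vanish.\<close>
  define e where "e = (\<lambda>i. (if i = j then 0 else d i) - u / w * c i)"
  have "D u - b * u = 0"
    unfolding u_def using d by (subst first_order_linear) (auto simp: constants_def)
  then have "D (u / w) = 0"
    using constant_ratio[of u b w] w by simp
  moreover have "u \<in> E" "w \<in> E"
    using d c yE unfolding u_def w(1) constants_def
    by (auto intro!: diff_subfield_sum[OF E] diff_subfieldD[OF E])
  ultimately have r: "u / w \<in> constants D E"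
    unfolding constants_def by (auto intro: diff_subfieldD[OF E])
  have "(\<Sum>i\<in>I. (if i = j then 0 else d i) * y i) = u"
    unfolding u_def using I by (intro sum.mono_neutral_cong_right) auto
  then have "(\<Sum>i\<in>I. e i * y i) = u - u / w * w"
    unfolding e_def left_diff_distrib sum_subtractf
    by (subst (3) w(1)) (simp add: sum_distrib_left mult.assoc)
  then have "(\<Sum>i\<in>I. e i * y i) = 0"
    using w(2) by simp
  moreover have "\<forall>i\<in>I. e i \<in> constants D E"
    using d c r diff_subfieldD(1)[OF E] unfolding e_def constants_def
    by (auto intro!: diff_subfieldD(5,8)[OF E] diff_subfieldD(4)[OF E, of "u / w"]
        simp: D_diff D_minus D_mult simp del: times_divide_eq_left)
  ultimately have e0: "\<forall>i\<in>I. e i = 0"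
    using ind unfolding const_independent_def by blast
  then have "u / w = 0"
    using e0 I(2) c(2) by (auto simp: e_def)
  then show "\<forall>i\<in>I - {j}. d i = 0"
    using e0 unfolding e_def by (metis Diff_iff diff_zero insertI1 mult_zero_left)
qed

text \<open>Induction on the order: for \<open>b = D (y j) / y j\<close> the operator factors
  through \<open>D - b\<close>, which kills \<open>y j\<close> and maps the other elements to
  independent solutions of an operator of order one less.\<close>

lemma const_independent_card_le:
  assumes E: "diff_subfield D E"
  shows "(\<And>i. c i \<in> E) \<Longrightarrow> finite I \<Longrightarrow> (\<And>i. i \<in> I \<Longrightarrow> y i \<in> E \<and> monic_op n c (y i) = 0) \<Longrightarrow>
    const_independent E I y \<Longrightarrow> card I \<le> n"
proof (induction n arbitrary: c I y)
  case 0
  have "I = {}"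
    using const_independent_nonzero[OF E 0(4) 0(2)] 0(3) by (fastforce simp: monic_op_def)
  then show ?case by simp
next
  case (Suc n)
  show ?case
  proof (cases "I = {}")
    case False
    then obtain j where j: "j \<in> I" by blast
    let ?w = "y j"
    let ?b = "D ?w / ?w"
    have w: "?w \<noteq> 0" using const_independent_nonzero[OF E Suc(5,3) j] .
    have wE: "?w \<in> E" using Suc(4) j by simp
    have b: "?b \<in> E" using wE by (auto intro: diff_subfieldD[OF E])
    have Dw: "D ?w = ?b * ?w" using w by simp
    have "riccati (Suc n) c ?b = 0"
      using monic_op_exp[OF Dw, of "Suc n" c] Suc(4)[OF j] w by simp
    then obtain d where d: "\<forall>i. d i \<in> E" "\<forall>y. monic_op (Suc n) c y = monic_op n d (D y - ?b * y)"
      using monic_op_right_division[OF E b, of c] Suc(2) by blast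
    have "const_independent E (I - {j}) (\<lambda>i. D (y i) - ?b * y i)"
    proof (rule const_independent_reduce[OF E Suc(5,3) j, of "\<lambda>i. if i = j then 1 else 0" ?w])
      show "?w = (\<Sum>i\<in>I. (if i = j then 1 else 0) * y i)"
        using Suc(3) j by (simp add: if_distrib[of "\<lambda>x. x * _"] cong: if_cong)
      show "(if i = j then 1 else 0) \<in> constants D E" for i
        using diff_subfieldD(1,2)[OF E] by (simp add: constants_def)
    qed (use Suc(4) w Dw in auto)
    then have "card (I - {j}) \<le> n"
      using Suc(3,4) d b
      by (intro Suc.IH[where c = d])
        (auto simp del: times_divide_eq_left intro: diff_subfieldD(7)[OF E] diff_subfieldD(8)[OF E diff_subfieldD(7)[OF E] diff_subfieldD(4)[OF E b]])
    then show ?thesis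
      using Suc(3) j by (simp add: card_Diff_singleton)
  qed simp
qed

end

subsection \<open>Specialization at \<open>y = 0\<close> over a special transcendental\<close>

locale special_extension = differential_field +
  fixes K :: "'a set" and y :: 'a
  assumes K: "diff_subfield D K" and special: "special_transcendental D K y"
begin

text \<open>\<open>sp z k\<close>: the element \<open>z\<close> of \<open>K(y)\<close> is regular at \<open>y = 0\<close> and takes the value \<open>k\<close> there.\<close>

definition sp :: "'a \<Rightarrow> 'a \<Rightarrow> bool" where
  "sp z k \<longleftrightarrow> (\<exists>p\<in>polys_over K. \<exists>q\<in>polys_over K.
     poly q y \<noteq> 0 \<and> poly q 0 \<noteq> 0 \<and> z = poly p y / poly q y \<and> k = poly p 0 / poly q 0)"

lemma transcendental: "p \<in> polys_over K \<Longrightarrow> poly p y = 0 \<Longrightarrow> p = 0"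
  using special unfolding special_transcendental_def transcendental_over_def by blast

lemma X_polys_over: "[:0, 1:] \<in> polys_over K"
  using polys_over_closed(1)[OF K] diff_subfieldD(1,2)[OF K] by (simp add: pCons_polys_over_iff)

lemma y_nonzero: "y \<noteq> 0"
  using transcendental[OF X_polys_over] by auto

lemma sp_closed: "sp z k \<Longrightarrow> k \<in> K"
  unfolding sp_def by (auto simp: poly_0_coeff_0 polys_over_def intro: diff_subfieldD(9)[OF K])

lemma sp_poly: "p \<in> polys_over K \<Longrightarrow> sp (poly p y) (poly p 0)"
  unfolding sp_def using polys_over_closed(2)[OF K] by (intro bexI[of _ p] bexI[of _ 1]) auto

lemma sp_const: "k \<in> K \<Longrightarrow> sp k k"
  using sp_poly[of "[:k:]"] polys_over_closed(1)[OF K] by (simp add: pCons_polys_over_iff)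

lemma sp_y: "sp y 0"
  using sp_poly[OF X_polys_over] by simp

lemma sp_add:
  assumes "sp z k" "sp w l"
  shows "sp (z + w) (k + l)"
proof -
  obtain p q r s where *: "p \<in> polys_over K" "q \<in> polys_over K" "r \<in> polys_over K" "s \<in> polys_over K"
    "poly q y \<noteq> 0" "poly q 0 \<noteq> 0" "z = poly p y / poly q y" "k = poly p 0 / poly q 0"
    "poly s y \<noteq> 0" "poly s 0 \<noteq> 0" "w = poly r y / poly s y" "l = poly r 0 / poly s 0"
    using assms unfolding sp_def by blast
  then show ?thesis
    unfolding sp_def
    by (intro bexI[of _ "p * s + r * q"] bexI[of _ "q * s"] polys_over_closed[OF K])
      (auto simp: add_frac_eq)
qed

lemma sp_mult:
  assumes "sp z k" "sp w l"
  shows "sp (z * w) (k * l)"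
proof -
  obtain p q r s where *: "p \<in> polys_over K" "q \<in> polys_over K" "r \<in> polys_over K" "s \<in> polys_over K"
    "poly q y \<noteq> 0" "poly q 0 \<noteq> 0" "z = poly p y / poly q y" "k = poly p 0 / poly q 0"
    "poly s y \<noteq> 0" "poly s 0 \<noteq> 0" "w = poly r y / poly s y" "l = poly r 0 / poly s 0"
    using assms unfolding sp_def by blast
  then show ?thesis
    unfolding sp_def
    by (intro bexI[of _ "p * r"] bexI[of _ "q * s"] polys_over_closed[OF K]) auto
qed

lemma sp_diff:
  assumes "sp z k" "sp w l"
  shows "sp (z - w) (k - l)"
  using sp_add[OF assms(1) sp_mult[OF sp_const[of "- 1"] assms(2)]] diff_subfieldD(2,5)[OF K] by simp

lemma sp_sum:
  assumes "\<And>i. i \<in> I \<Longrightarrow> sp (f i) (g i)"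
  shows "sp (\<Sum>i\<in>I. f i) (\<Sum>i\<in>I. g i)"
  using assms
  by (induction I rule: infinite_finite_induct) (auto intro: sp_add sp_const diff_subfieldD(1)[OF K])

lemma sp_power:
  assumes "sp z k"
  shows "sp (z ^ n) (k ^ n)"
  by (induction n) (auto intro: sp_mult assms sp_const diff_subfieldD(2)[OF K])

text \<open>Transcendence of \<open>y\<close> enters here: a numerator vanishing at \<open>y\<close>
  is the zero polynomial. Thus \<open>sp\<close> is a partial function.\<close>

lemma sp_unique:
  assumes "sp z k" "sp z l"
  shows "k = l"
proof -
  have "sp 0 (k - l)" using sp_diff[OF assms] by simp
  then obtain p q where "p \<in> polys_over K" "poly q y \<noteq> 0" "0 = poly p y / poly q y"
    "k - l = poly p 0 / poly q 0"
    unfolding sp_def by blast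
  moreover from this have "p = 0" by (intro transcendental) auto
  ultimately show ?thesis by simp
qed

lemma sp_nonzero: "sp z k \<Longrightarrow> k \<noteq> 0 \<Longrightarrow> z \<noteq> 0"
  using sp_unique[of 0 k 0] sp_const[of 0] diff_subfieldD(1)[OF K] by blast

lemma sp_inverse:
  assumes "sp z k" "k \<noteq> 0"
  shows "sp (inverse z) (inverse k)"
proof -
  obtain p q where "p \<in> polys_over K" "q \<in> polys_over K"
    "poly q y \<noteq> 0" "poly q 0 \<noteq> 0" "z = poly p y / poly q y" "k = poly p 0 / poly q 0"
    using assms unfolding sp_def by blast
  then show ?thesis
    unfolding sp_def using assms(2) sp_nonzero[OF assms]
    by (intro bexI[of _ q] bexI[of _ p]) auto
qed

lemma sp_divide: "sp z k \<Longrightarrow> sp w l \<Longrightarrow> l \<noteq> 0 \<Longrightarrow> sp (z / w) (k / l)"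
  unfolding divide_inverse by (intro sp_mult sp_inverse)

text \<open>If \<open>Q\<close> vanished at 0, the indeterminate would divide both
  \<open>y P\<close> and \<open>Q\<close>, against relative primality. So \<open>D y\<close> is
  \<open>y\<close> times an element regular at \<open>y = 0\<close>.\<close>

lemma derivative_y: "\<exists>p\<in>polys_over K. \<exists>q\<in>polys_over K. poly q y \<noteq> 0 \<and> poly q 0 \<noteq> 0 \<and>
    D y = y * poly p y / poly q y"
proof -
  obtain P Q where PQ: "P \<in> polys_over K" "Q \<in> polys_over K"
    "relatively_prime_over K ([:0, 1:] * P) Q" "D y = poly ([:0, 1:] * P) y / poly Q y"
    using special unfolding special_transcendental_def by blast
  have "poly Q 0 \<noteq> 0"
  proof
    assume 0: "poly Q 0 = 0"
    obtain a V where V: "Q = pCons a V" by (cases Q)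
    then have "Q = [:0, 1:] * V" "V \<in> polys_over K"
      using 0 PQ(2) by (auto simp: pCons_polys_over_iff)
    then have "is_unit [:0, 1 :: 'a:]"
      using PQ(1,3) X_polys_over unfolding relatively_prime_over_def by blast
    then show False by (simp add: is_unit_iff_degree)
  qed
  moreover from this have "poly Q y \<noteq> 0"
    using transcendental[OF PQ(2)] by auto
  ultimately show ?thesis
    using PQ by auto
qed

lemma sp_D_y: "sp (D y) 0"
proof -
  obtain p q where "p \<in> polys_over K" "q \<in> polys_over K"
    "poly q y \<noteq> 0" "poly q 0 \<noteq> 0" "D y = y * poly p y / poly q y"
    using derivative_y by blast
  then show ?thesis
    using sp_divide[OF sp_mult[OF sp_y sp_poly] sp_poly] by fastforce
qed

text \<open>In the chain rule the term \<open>poly (pderiv p) y * D y\<close> specializes to 0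
  because \<open>D y\<close> does; what remains is the derivative of the constant coefficient. The
  quotient rule extends this to fractions.\<close>

lemma sp_D:
  assumes "sp z k"
  shows "sp (D z) (D k)"
proof -
  have D_poly_sp: "sp (D (poly p y)) (D (poly p 0))" if "p \<in> polys_over K" for p
  proof -
    have "sp (D (poly p y)) (poly (map_poly D p) 0 + poly (pderiv p) 0 * 0)"
      unfolding D_poly using that
      by (intro sp_add sp_mult sp_poly sp_D_y polys_over_closed[OF K] D_0)
    then show ?thesis by (simp add: poly_0_coeff_0 coeff_map_poly)
  qed
  obtain p q where "p \<in> polys_over K" "q \<in> polys_over K"
    "poly q y \<noteq> 0" "poly q 0 \<noteq> 0" "z = poly p y / poly q y" "k = poly p 0 / poly q 0"
    using assms unfolding sp_def by blast
  then show ?thesis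
    by (simp only: D_divide) (intro sp_divide sp_diff sp_mult sp_power sp_poly D_poly_sp power_not_zero)
qed

section \<open>The order at \<open>y = 0\<close>\<close>

definition has_order :: "'a \<Rightarrow> int \<Rightarrow> bool" where
  "has_order z N \<longleftrightarrow> (\<exists>u k. k \<noteq> 0 \<and> sp u k \<and> z = y powi N * u)"

lemma has_order_mult:
  assumes "has_order z M" "has_order w N"
  shows "has_order (z * w) (M + N)"
proof -
  obtain u k v l where "k \<noteq> 0" "sp u k" "z = y powi M * u" "l \<noteq> 0" "sp v l" "w = y powi N * v"
    using assms unfolding has_order_def by blast
  then show ?thesis
    unfolding has_order_def using y_nonzero
    by (intro exI[of _ "u * v"] exI[of _ "k * l"]) (auto simp: power_int_add intro: sp_mult)
qed

lemma has_order_inverse: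
  assumes "has_order z N"
  shows "has_order (inverse z) (- N)"
proof -
  obtain u k where "k \<noteq> 0" "sp u k" "z = y powi N * u"
    using assms unfolding has_order_def by blast
  then show ?thesis
    unfolding has_order_def
    by (intro exI[of _ "inverse u"] exI[of _ "inverse k"]) (auto simp: power_int_minus intro: sp_inverse)
qed

lemma has_order_power_int:
  assumes "has_order z N"
  shows "has_order (z powi m) (m * N)"
proof -
  have "has_order 1 0"
    unfolding has_order_def using sp_const[OF diff_subfieldD(2)[OF K]]
    by (intro exI[of _ 1]) auto
  then have *: "has_order (w ^ n) (int n * M)" if "has_order w M" for w n M
  proof (induction n)
    case (Suc n)
    then show ?case
      using has_order_mult[OF that Suc.IH] by (simp add: algebra_simps)
  qed simp
  show ?thesis
  proof (cases "m \<ge> 0")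
    case True
    then show ?thesis using *[OF assms, of "nat m"] by (simp add: power_int_def)
  next
    case False
    then show ?thesis using *[OF has_order_inverse[OF assms], of "nat (- m)"] by (simp add: power_int_def)
  qed
qed

text \<open>Since \<open>D y\<close> is a rational function of \<open>y\<close>, the field
  \<open>K(y)\<close> is already closed under \<open>D\<close> and hence contains all of
  \<open>diff_adjoin D K y\<close>.\<close>

lemma diff_adjoin_fraction:
  assumes "z \<in> diff_adjoin D K y"
  shows "\<exists>p\<in>polys_over K. \<exists>q\<in>polys_over K. poly q y \<noteq> 0 \<and> z = poly p y / poly q y"
proof -
  define R where "R = {z. \<exists>p\<in>polys_over K. \<exists>q\<in>polys_over K. poly q y \<noteq> 0 \<and> z = poly p y / poly q y}"
  have RI: "poly p y / poly q y \<in> R" if "p \<in> polys_over K" "q \<in> polys_over K" "poly q y \<noteq> 0" for p q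
    unfolding R_def using that by blast
  have poly_R: "poly p y \<in> R" if "p \<in> polys_over K" for p
    using RI[OF that polys_over_closed(2)[OF K]] by simp
  have add: "z + w \<in> R" and mult: "z * w \<in> R" if zw: "z \<in> R" "w \<in> R" for z w
  proof -
    obtain p q r s where *: "p \<in> polys_over K" "q \<in> polys_over K" "r \<in> polys_over K" "s \<in> polys_over K"
      "poly q y \<noteq> 0" "z = poly p y / poly q y" "poly s y \<noteq> 0" "w = poly r y / poly s y"
      using zw unfolding R_def by blast
    show "z + w \<in> R"
      using RI[of "p * s + r * q" "q * s"] * by (simp add: add_frac_eq polys_over_closed[OF K])
    show "z * w \<in> R"
      using RI[of "p * r" "q * s"] * by (simp add: polys_over_closed[OF K])
  qed
  have inv: "inverse z \<in> R" if "z \<in> R" for z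
  proof -
    obtain p q where *: "p \<in> polys_over K" "q \<in> polys_over K" "poly q y \<noteq> 0" "z = poly p y / poly q y"
      using \<open>z \<in> R\<close> unfolding R_def by blast
    then show ?thesis
      using RI[of q p] poly_R[OF polys_over_closed(1)[OF K]] by (cases "poly p y = 0") auto
  qed
  have minus: "- z \<in> R" if "z \<in> R" for z
    using mult[OF poly_R[of "- 1"] that] polys_over_closed(2,5)[OF K] by simp
  have D_y_R: "D y \<in> R"
  proof -
    obtain p q where "p \<in> polys_over K" "q \<in> polys_over K" "poly q y \<noteq> 0" "D y = y * poly p y / poly q y"
      using derivative_y by blast
    then show ?thesis
      using RI[of "[:0, 1:] * p" q] polys_over_closed(4)[OF K X_polys_over, of p] by simp
  qed
  have D_poly_R: "D (poly p y) \<in> R" if "p \<in> polys_over K" for p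
    unfolding D_poly using that
    by (intro add mult poly_R D_y_R polys_over_closed[OF K] D_0)
  have D_R: "D z \<in> R" if "z \<in> R" for z
  proof -
    obtain p q where *: "p \<in> polys_over K" "q \<in> polys_over K" "z = poly p y / poly q y"
      using \<open>z \<in> R\<close> unfolding R_def by blast
    have "D z = (D (poly p y) * poly q y + - (poly p y * D (poly q y))) * (inverse (poly q y) * inverse (poly q y))"
      unfolding *(3) D_divide by (simp add: divide_inverse power2_eq_square)
    also have "\<dots> \<in> R"
      using * by (intro add mult minus inv D_poly_R poly_R)
    finally show ?thesis .
  qed
  have const_R: "k \<in> R" if "k \<in> K" for k
    using poly_R[of "[:k:]"] that polys_over_closed(1)[OF K] by (simp add: pCons_polys_over_iff)
  have "diff_subfield D R"
    unfolding diff_subfield_def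
    by (intro conjI ballI const_R[OF diff_subfieldD(1)[OF K]] const_R[OF diff_subfieldD(2)[OF K]]
        add mult minus inv D_R)
  moreover have "y \<in> R"
    using poly_R[OF X_polys_over] by simp
  ultimately have "diff_adjoin D K y \<subseteq> R"
    using const_R by (intro diff_adjoin_subset) auto
  with assms show ?thesis unfolding R_def by blast
qed

text \<open>Numerator and denominator each split into a power of \<open>y\<close> and a factor that
  does not vanish at 0; the order is the difference of the exponents.\<close>

lemma has_order_exists:
  assumes "z \<in> diff_adjoin D K y" "z \<noteq> 0"
  shows "\<exists>N. has_order z N"
proof -
  obtain p q where pq: "p \<in> polys_over K" "q \<in> polys_over K" "poly q y \<noteq> 0" "z = poly p y / poly q y"
    using diff_adjoin_fraction[OF assms(1)] by blast
  then have "p \<noteq> 0" "q \<noteq> 0" using assms(2) by auto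
  have *: "\<exists>N. has_order (poly r y) N" if "r \<in> polys_over K" "r \<noteq> 0" for r
  proof -
    obtain m s where s: "s \<in> polys_over K" "poly s 0 \<noteq> 0" "\<forall>x. poly r x = x ^ m * poly s x"
      using poly_split_power[OF \<open>r \<in> polys_over K\<close> \<open>r \<noteq> 0\<close>] by blast
    then have "has_order (poly r y) (int m)"
      unfolding has_order_def using sp_poly by (intro exI[of _ "poly s y"] exI[of _ "poly s 0"]) auto
    then show ?thesis ..
  qed
  obtain M N where "has_order (poly p y) M" "has_order (poly q y) N"
    using * pq \<open>p \<noteq> 0\<close> \<open>q \<noteq> 0\<close> by meson
  then have "has_order z (M + - N)"
    unfolding pq(4) divide_inverse by (intro has_order_mult has_order_inverse)
  then show ?thesis ..
qed

lemma sp_of_has_order: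
  assumes "has_order z N" "N \<ge> 0"
  shows "\<exists>k. sp z k \<and> (N > 0 \<longrightarrow> k = 0) \<and> (N = 0 \<longrightarrow> k \<noteq> 0)"
proof -
  obtain u k where *: "k \<noteq> 0" "sp u k" "z = y powi N * u"
    using assms(1) unfolding has_order_def by blast
  have "z = y ^ nat N * u"
    using *(3) assms(2) by (simp add: power_int_def)
  then have "sp z (0 ^ nat N * k)"
    using sp_mult[OF sp_power[OF sp_y] *(2)] by simp
  then show ?thesis
    using *(1) by (intro exI[of _ "0 ^ nat N * k"]) (auto simp: power_0_left)
qed

text \<open>A pole of \<open>b\<close> at \<open>y = 0\<close> would make \<open>b\<^sup>n\<close> the unique dominant term of the Riccati equation,
  because \<open>D\<close> does not increase the order of a pole.\<close>

lemma riccati_pole: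
  assumes "sp (inverse b) 0" "b \<noteq> 0"
  shows "sp (ric b n * inverse b ^ n) 1"
proof (induction n)
  case 0
  then show ?case using sp_const[OF diff_subfieldD(2)[OF K]] by simp
next
  case (Suc n)
  let ?t = "inverse b" and ?R = "ric b n * inverse b ^ n"
  \<comment> \<open>The product rule for \<open>?R\<close>, solved for the term with
    \<open>D (ric b n)\<close>. Then only \<open>?t\<close>, \<open>?R\<close> and their derivatives
    remain, and all of these have known values at \<open>y = 0\<close>.\<close>
  have "D (ric b n) * ?t ^ Suc n = ?t * D ?R - ric b n * (?t * D (?t ^ n))"
    by (simp add: D_mult algebra_simps)
  also have "\<dots> = ?t * D ?R - of_nat n * D ?t * ?R"
    unfolding mult_D_power by (simp add: algebra_simps)
  finally have "ric b (Suc n) * ?t ^ Suc n = ?t * D ?R - of_nat n * D ?t * ?R + ?R"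
    using assms(2) by (simp add: distrib_right)
  moreover have "sp (?t * D ?R - of_nat n * D ?t * ?R + ?R) (0 * D 1 - of_nat n * D 0 * 1 + 1)"
    by (intro sp_add sp_diff sp_mult sp_D assms(1) Suc.IH sp_const diff_subfield_of_nat[OF K])
  ultimately show ?case by simp
qed

text \<open>If \<open>b\<close> is regular at \<open>y = 0\<close>, its value there solves the same
  equation, as the coefficients lie in \<open>K\<close> and are unchanged by specialization. A pole
  of \<open>b\<close> is impossible by the dominant term.\<close>

lemma riccati_descent:
  assumes b: "b \<in> diff_adjoin D K y" "riccati n c b = 0" and c: "\<And>i. c i \<in> K"
  shows "\<exists>b'\<in>K. riccati n c b' = 0"
proof -
  have ric_sp: "sp (ric b i) (ric k i)" if "sp b k" for k i
    by (induction i) (auto intro: sp_add sp_mult sp_D that sp_const diff_subfieldD(2)[OF K])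
  have regular: ?thesis if "sp b k" for k
  proof (intro bexI)
    have "sp (riccati n c b) (riccati n c k)"
      unfolding riccati_def by (intro sp_add sp_sum sp_mult sp_const c ric_sp that)
    then show "riccati n c k = 0"
      using sp_unique[OF _ sp_const[OF diff_subfieldD(1)[OF K]]] b(2) by simp
    show "k \<in> K" using sp_closed[OF that] .
  qed
  show ?thesis
  proof (cases "b = 0")
    case True
    then show ?thesis using regular[of 0] sp_const diff_subfieldD(1)[OF K] by simp
  next
    case False
    then obtain N where N: "has_order b N" using has_order_exists[OF b(1)] by blast
    show ?thesis
    proof (cases "N \<ge> 0")
      case True
      then show ?thesis using sp_of_has_order[OF N] regular by blast
    next
      case False
      let ?t = "inverse b"
      have t: "sp ?t 0"
        using sp_of_has_order[OF has_order_inverse[OF N]] False by auto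
      \<comment> \<open>After multiplication by \<open>?t ^ n\<close>, the term of index
        \<open>i < n\<close> keeps a factor \<open>?t ^ (n - i)\<close> with positive exponent and
        specializes to 0, while the leading term specializes to 1. So 0 would specialize to
        1.\<close>
      have "c i * ric b i * ?t ^ n = c i * (ric b i * ?t ^ i) * ?t ^ (n - i)" if "i < n" for i
        using that by (simp add: mult.assoc power_add[symmetric])
      then have "(\<Sum>i<n. c i * ric b i * ?t ^ n) = (\<Sum>i<n. c i * (ric b i * ?t ^ i) * ?t ^ (n - i))"
        by (intro sum.cong) auto
      then have "riccati n c b * ?t ^ n =
          ric b n * ?t ^ n + (\<Sum>i<n. c i * (ric b i * ?t ^ i) * ?t ^ (n - i))"
        unfolding riccati_def by (simp only: distrib_right sum_distrib_right)
      moreover have "sp (ric b n * ?t ^ n + (\<Sum>i<n. c i * (ric b i * ?t ^ i) * ?t ^ (n - i)))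
          (1 + (\<Sum>i<n. c i * 1 * 0 ^ (n - i)))"
        by (intro sp_add sp_sum sp_mult sp_const c riccati_pole t \<open>b \<noteq> 0\<close> sp_power)
      moreover have "(\<Sum>i<n. c i * 1 * 0 ^ (n - i)) = 0"
        by (intro sum.neutral) (auto simp: power_0_left)
      ultimately have "sp 0 1" using b(2) by simp
      then show ?thesis
        using sp_unique[OF _ sp_const[OF diff_subfieldD(1)[OF K]]] by fastforce
    qed
  qed
qed

text \<open>A relation for \<open>v\<close> can be divided by a power of \<open>v\<close> until its
  constant coefficient is nonzero. As \<open>v\<close> specializes to 0, the left side then
  specializes to that coefficient and cannot be 0.\<close>

lemma transcendental_of_order:
  assumes "has_order v N" "N > 0"
  shows "transcendental_over K v"
  unfolding transcendental_over_def
proof (intro ballI impI notI)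
  fix p assume p: "p \<in> polys_over K" "p \<noteq> 0" "poly p v = 0"
  obtain m q where q: "q \<in> polys_over K" "poly q 0 \<noteq> 0" "\<forall>x. poly p x = x ^ m * poly q x"
    using poly_split_power[OF p(1,2)] by blast
  obtain u k where "k \<noteq> 0" "sp u k" "v = y powi N * u"
    using assms(1) unfolding has_order_def by blast
  then have "v \<noteq> 0" using sp_nonzero y_nonzero by simp
  have v: "sp v 0" using sp_of_has_order[OF assms(1)] assms(2) by auto
  have "sp (poly q v) (poly q 0)"
    using q(1)
  proof (induction q)
    case (pCons a q)
    then show ?case
      using sp_add[OF sp_const sp_mult[OF v pCons.IH]] by (simp add: pCons_polys_over_iff)
  qed (simp add: sp_const diff_subfieldD(1)[OF K])
  then have "poly q v \<noteq> 0" using q(2) sp_nonzero by blast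
  then show False using p(3) q(3) \<open>v \<noteq> 0\<close> by simp
qed

text \<open>The value \<open>k\<close> of \<open>w\<close> at \<open>y = 0\<close> is nonzero and
  satisfies the same equation \<open>D k = b * k\<close>. So \<open>w / k\<close> is a constant, and
  it lies in \<open>K\<close> because there are no new constants.\<close>

lemma exp_integral_order_0:
  assumes "constants D (diff_adjoin D K y) = constants D K" "K0 \<subseteq> K"
    and w: "w \<in> diff_adjoin D K y" "exp_integral_over D K0 w" "has_order w 0"
  shows "w \<in> K"
proof -
  obtain b where b: "b \<in> K" "D w = b * w"
    using w(2) assms(2) unfolding exp_integral_over_def by auto
  obtain k where k: "sp w k" "k \<noteq> 0"
    using sp_of_has_order[OF w(3)] by auto
  have kK: "k \<in> K" using sp_closed[OF k(1)] .
  have "D k = b * k"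
    using sp_unique[OF sp_D[OF k(1)]] sp_mult[OF sp_const[OF b(1)] k(1)] b(2) by simp
  then have "D (w / k) = 0" using constant_ratio b(2) k(2) by blast
  moreover have "w / k \<in> diff_adjoin D K y"
    using w(1) kK diff_adjoin_base[of K D y] by (intro diff_subfieldD(9)[OF diff_subfield_adjoin]) auto
  ultimately have "w / k \<in> K"
    using assms(1) unfolding constants_def by blast
  then have "w / k * k \<in> K" using kK by (intro diff_subfieldD(4)[OF K])
  then show ?thesis using k(2) by simp
qed

text \<open>The exponentials of integrals over \<open>K0\<close> in \<open>K(y)\<close> modulo those in \<open>K\<close> embed into the
  integers by the order at \<open>y = 0\<close>, so they form a cyclic group; \<open>v\<close> is a generator.\<close>

lemma exp_integral_generator:
  assumes const: "constants D (diff_adjoin D K y) = constants D K"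
    and K0: "diff_subfield D K0" "K0 \<subseteq> K"
    and F: "diff_subfield D F" "\<And>w. w \<in> K \<Longrightarrow> exp_integral_over D K0 w \<Longrightarrow> w \<in> F"
  shows "(\<forall>w\<in>diff_adjoin D K y. exp_integral_over D K0 w \<longrightarrow> w \<in> F) \<or>
    (\<exists>v\<in>diff_adjoin D K y. exp_integral_over D K0 v \<and> transcendental_over K v \<and>
      (\<forall>w\<in>diff_adjoin D K y. exp_integral_over D K0 w \<longrightarrow> w \<in> diff_adjoin D F v))"
proof -
  define E where "E = diff_adjoin D K y"
  have E: "diff_subfield D E" unfolding E_def by (rule diff_subfield_adjoin)
  \<comment> \<open>The positive orders that occur. Inverses turn negative orders into positive
    ones, so if there are none, all these exponentials have order 0 and lie in
    \<open>K\<close>.\<close>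
  define S where "S n \<longleftrightarrow> n > 0 \<and> (\<exists>v\<in>E. exp_integral_over D K0 v \<and> has_order v (int n))" for n
  have in_K: "w \<in> K" if "w \<in> E" "exp_integral_over D K0 w" "has_order w 0" for w
    using exp_integral_order_0[OF const K0(2)] that unfolding E_def by blast
  have order: "\<exists>N. has_order w N" if "w \<in> E" "exp_integral_over D K0 w" for w
    using has_order_exists that unfolding E_def exp_integral_over_def by blast
  have S_abs: "S (nat \<bar>N\<bar>)" if "w \<in> E" "exp_integral_over D K0 w" "has_order w N" "N \<noteq> 0" for w N
  proof (cases "N > 0")
    case True
    then show ?thesis unfolding S_def using that by auto
  next
    case False
    then show ?thesis
      unfolding S_def using that has_order_inverse[OF that(3)]
      by (auto intro!: bexI[of _ "inverse w"] exp_integral_over_inverse[OF K0(1)] diff_subfieldD(6)[OF E])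
  qed
  show ?thesis
  proof (cases "\<exists>n. S n")
    case False
    then have "w \<in> F" if "w \<in> E" "exp_integral_over D K0 w" for w
      using order[OF that] S_abs[OF that] in_K[OF that] F(2)[OF _ that(2)] by metis
    then show ?thesis unfolding E_def by blast
  next
    case True
    define n where "n = (LEAST n. S n)"
    have "S n" unfolding n_def using True by (rule LeastI_ex)
    then obtain v where v: "n > 0" "v \<in> E" "exp_integral_over D K0 v" "has_order v (int n)"
      unfolding S_def by blast
    have "w \<in> diff_adjoin D F v" if w: "w \<in> E" "exp_integral_over D K0 w" for w
    proof -
      obtain N where N: "has_order w N" using order[OF w] by blast
      \<comment> \<open>Division with remainder by the least positive order: the order of
        \<open>u\<close> is below \<open>n\<close>, hence 0 by minimality, and \<open>u\<close> lies
        in \<open>K\<close> and so in \<open>F\<close>.\<close>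
      define m where "m = N div int n"
      define u where "u = w * v powi (- m)"
      have uE: "u \<in> E" "exp_integral_over D K0 u"
        unfolding u_def using w v
        by (auto intro!: diff_subfieldD(4)[OF E] diff_subfield_power_int[OF E]
            exp_integral_over_mult[OF K0(1)] exp_integral_over_power_int[OF K0(1)])
      have "has_order u (N mod int n)"
        unfolding u_def using has_order_mult[OF N has_order_power_int[OF v(4), of "- m"]]
        by (simp add: m_def minus_div_mult_eq_mod)
      moreover have "\<not> S (nat \<bar>N mod int n\<bar>)"
        using not_less_Least[of _ S] v(1) unfolding n_def[symmetric]
        by (metis abs_of_nonneg nat_less_iff of_nat_0_less_iff pos_mod_bound pos_mod_sign)
      ultimately have "has_order u 0"
        using S_abs[OF uE] by metis
      then have "u \<in> F" using in_K[OF uE] F(2) uE(2) by blast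
      then have "u * v powi m \<in> diff_adjoin D F v"
        using diff_adjoin_base[of F D v] diff_adjoin_generator[of v D F]
        by (intro diff_subfieldD(4)[OF diff_subfield_adjoin] diff_subfield_power_int[OF diff_subfield_adjoin]) auto
      moreover have "v \<noteq> 0" using v(3) unfolding exp_integral_over_def by blast
      ultimately show ?thesis
        unfolding u_def by (simp add: power_int_minus mult.assoc)
    qed
    then show ?thesis
      using v transcendental_of_order[OF v(4)] unfolding E_def by auto
  qed
qed

end

subsection \<open>Towers inside a fixed extension\<close>

text \<open>All fields lie inside a fixed \<open>E\<close>. When \<open>E\<close> has only the
  constants of \<open>K\<close>, so does every intermediate field, and the condition on constants in
  \<open>diff_chain\<close> follows at the end.\<close>

inductive liouville_tower :: "('a::field_char_0 \<Rightarrow> 'a) \<Rightarrow> 'a set \<Rightarrow> 'a set \<Rightarrow> 'a set \<Rightarrow> bool"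
  for D K E where
  base: "liouville_tower D K E K"
| step: "liouville_tower D K E F \<Longrightarrow> y \<in> E \<Longrightarrow>
    integral_over D F y \<or> exp_integral_over D F y \<and> transcendental_over F y \<Longrightarrow>
    liouville_tower D K E (diff_adjoin D F y)"

lemma liouville_tower_mono:
  assumes "liouville_tower D K E F" "E \<subseteq> E'"
  shows "liouville_tower D K E' F"
  using assms by induction (auto intro: liouville_tower.intros)

lemma liouville_tower_subfield:
  assumes "liouville_tower D K E F" "diff_subfield D K" "diff_subfield D E" "K \<subseteq> E"
  shows "diff_subfield D F \<and> K \<subseteq> F \<and> F \<subseteq> E"
  using assms
proof induction
  case (step F y)
  then show ?case
    using diff_subfield_adjoin diff_adjoin_base[of F D y] diff_adjoin_subset[of D E F y] by blast
qed auto

lemma liouville_tower_chain: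
  assumes "liouville_tower D K E F" "diff_subfield D K" "diff_subfield D E" "K \<subseteq> E"
    and const: "constants D E = constants D K"
  shows "\<exists>m Ks. diff_chain D m Ks \<and> Ks 0 = K \<and> Ks m = F \<and>
    (\<forall>i<m. \<exists>y. Ks (Suc i) = diff_adjoin D (Ks i) y \<and>
      (integral_over D (Ks i) y \<or> exp_integral_over D (Ks i) y \<and> transcendental_over (Ks i) y))"
  using assms
proof induction
  case base
  then show ?case
    by (intro exI[of _ 0] exI[of _ "\<lambda>_. K"]) (simp add: diff_chain_def)
next
  case (step F y)
  then obtain m Ks where IH: "diff_chain D m Ks" "Ks 0 = K" "Ks m = F"
    "\<forall>i<m. \<exists>y. Ks (Suc i) = diff_adjoin D (Ks i) y \<and>
      (integral_over D (Ks i) y \<or> exp_integral_over D (Ks i) y \<and> transcendental_over (Ks i) y)"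
    by blast
  have F: "diff_subfield D F \<and> K \<subseteq> F \<and> F \<subseteq> E"
    using liouville_tower_subfield step by blast
  have F': "diff_subfield D (diff_adjoin D F y) \<and> F \<subseteq> diff_adjoin D F y \<and> diff_adjoin D F y \<subseteq> E"
    using diff_subfield_adjoin diff_adjoin_base[of F D y] diff_adjoin_subset[of D E F y] F step by blast
  have "constants D (diff_adjoin D F y) = constants D F"
    using F F' const unfolding constants_def by blast
  then have ext: "diff_extension D F (diff_adjoin D F y)"
    using F F' unfolding diff_extension_def by blast
  let ?Ks = "Ks(Suc m := diff_adjoin D F y)"
  have "diff_chain D (Suc m) ?Ks"
    using IH ext unfolding diff_chain_def by (auto simp: less_Suc_eq)
  moreover have "\<forall>i<Suc m. \<exists>y. ?Ks (Suc i) = diff_adjoin D (?Ks i) y \<and>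
      (integral_over D (?Ks i) y \<or> exp_integral_over D (?Ks i) y \<and> transcendental_over (?Ks i) y)"
    using IH step(3) by (auto simp: less_Suc_eq)
  moreover have "?Ks 0 = K" "?Ks (Suc m) = diff_adjoin D F y"
    using IH(2) by simp_all
  ultimately show ?case by blast
qed

text \<open>All derivatives lie in the initial field \<open>F\<close>, so each \<open>z i\<close> is
  still an integral over every later field and they can be adjoined one by one.\<close>

lemma liouville_tower_integrals:
  assumes "finite I" "liouville_tower D K E F" "diff_subfield D K" "diff_subfield D E" "K \<subseteq> E"
    and "\<And>i. i \<in> I \<Longrightarrow> z i \<in> E \<and> D (z i) \<in> F"
  shows "\<exists>F'. liouville_tower D K E F' \<and> F \<subseteq> F' \<and> (\<forall>i\<in>I. z i \<in> F')"
  using assms(1,6)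
proof (induction I)
  case empty
  then show ?case using assms(2) by blast
next
  case (insert j I)
  then obtain F' where F': "liouville_tower D K E F'" "F \<subseteq> F'" "\<forall>i\<in>I. z i \<in> F'"
    by blast
  have "liouville_tower D K E (diff_adjoin D F' (z j))"
    using F' insert.prems by (intro liouville_tower.step) (auto simp: integral_over_def)
  then show ?case
    using F' diff_adjoin_base[of F' D "z j"] diff_adjoin_generator[of "z j" D F'] by blast
qed

context differential_field
begin

text \<open>Induction on the order. Descent keeps \<open>b\<close>, and with it the coefficients of
  the left factor, in \<open>K\<close>; the exponential \<open>w\<close> is therefore already in
  \<open>F\<close>, and only integrals are adjoined beyond \<open>F\<close>.\<close>

lemma liouville_tower_solutions:
  assumes K: "diff_subfield D K" and E: "diff_subfield D E" and KE: "K \<subseteq> E"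
    and const: "constants D E = constants D K"
    and descent: "\<And>n c b. (\<And>i. c i \<in> K) \<Longrightarrow> b \<in> E \<Longrightarrow> riccati n c b = 0 \<Longrightarrow> \<exists>b'\<in>K. riccati n c b' = 0"
    and F: "liouville_tower D K E F" "\<And>w. w \<in> E \<Longrightarrow> exp_integral_over D K w \<Longrightarrow> w \<in> F"
  shows "(\<And>i. c i \<in> K) \<Longrightarrow> finite I \<Longrightarrow> card I = n \<Longrightarrow>
    (\<And>i. i \<in> I \<Longrightarrow> y i \<in> E \<and> monic_op n c (y i) = 0) \<Longrightarrow> const_independent E I y \<Longrightarrow>
    \<exists>F'. liouville_tower D K E F' \<and> F \<subseteq> F' \<and> (\<forall>i\<in>I. y i \<in> F')"
proof (induction n arbitrary: c I y)
  case 0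
  then show ?case using F(1) by auto
next
  case (Suc n)
  note c = Suc.prems(1) and I = Suc.prems(2,3) and y = Suc.prems(4) and ind = Suc.prems(5)
  obtain j0 where j0: "j0 \<in> I" using I(2) by fastforce
  let ?b0 = "D (y j0) / y j0"
  have y0: "y j0 \<noteq> 0" using const_independent_nonzero[OF E ind I(1) j0] .
  then have "riccati (Suc n) c ?b0 = 0"
    using monic_op_exp[of "y j0" ?b0 "Suc n" c] y[OF j0] by simp
  moreover have "?b0 \<in> E" using y[OF j0] by (auto intro: diff_subfieldD[OF E])
  ultimately obtain b where b: "b \<in> K" "riccati (Suc n) c b = 0"
    using descent c by blast
  obtain d where d: "\<forall>i. d i \<in> K" "\<forall>y. monic_op (Suc n) c y = monic_op n d (D y - b * y)"
    using monic_op_right_division[OF K b(1) c b(2)] by blast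
  let ?f = "\<lambda>i. D (y i) - b * y i"
  have f: "?f i \<in> E \<and> monic_op n d (?f i) = 0" if "i \<in> I" for i
    using y[OF that] d(2) b(1) KE by (auto intro!: diff_subfieldD(4,7,8)[OF E])
  \<comment> \<open>The images are \<open>n + 1\<close> solutions of an operator of order
    \<open>n\<close>, hence dependent. A dependence relation gives the nonzero \<open>w\<close> in
    the kernel of \<open>D - b\<close>.\<close>
  have "\<not> const_independent E I ?f"
  proof
    assume "const_independent E I ?f"
    then have "card I \<le> n"
      using const_independent_card_le[OF E, of d I ?f n] d(1) KE I(1) f by blast
    with I(2) show False by simp
  qed
  then obtain e j where e: "\<forall>i\<in>I. e i \<in> constants D E" "(\<Sum>i\<in>I. e i * ?f i) = 0" "j \<in> I" "e j \<noteq> 0"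
    unfolding const_independent_def by blast
  define w where "w = (\<Sum>i\<in>I. e i * y i)"
  have w0: "w \<noteq> 0"
    using e ind unfolding w_def const_independent_def by blast
  have "D w - b * w = 0"
    unfolding w_def using e(1,2) by (subst first_order_linear) (auto simp: constants_def)
  then have Dw: "D w = b * w" by simp
  have wE: "w \<in> E"
    unfolding w_def using e(1) y by (auto simp: constants_def intro!: diff_subfield_sum[OF E] diff_subfieldD(4)[OF E])
  have "w \<in> F"
    using F(2)[OF wE] w0 Dw b(1) unfolding exp_integral_over_def by blast
  have "const_independent E (I - {j}) ?f"
    using const_independent_reduce[OF E ind I(1) e(3), of e w b] e w0 Dw y w_def by blast
  then obtain F' where F': "liouville_tower D K E F'" "F \<subseteq> F'" "\<forall>i\<in>I - {j}. ?f i \<in> F'"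
    using Suc.IH[of d "I - {j}" ?f] d(1) I f e(3) by auto
  have F'f: "diff_subfield D F'" "K \<subseteq> F'"
    using liouville_tower_subfield[OF F'(1) K E KE] by auto
  have wF': "w \<in> F'" using \<open>w \<in> F\<close> F'(2) by blast
  \<comment> \<open>Variation of constants: \<open>y i / w\<close> has derivative
    \<open>?f i / w\<close> and is thus an integral over \<open>F'\<close>.\<close>
  have "y i / w \<in> E \<and> D (y i / w) \<in> F'" if i: "i \<in> I - {j}" for i
  proof -
    have "D (y i / w) = ?f i / w"
      using w0 by (simp add: D_divide Dw field_simps power2_eq_square)
    then show ?thesis
      using F'(3) i wF' wE y by (auto intro: diff_subfieldD(9)[OF F'f(1)] diff_subfieldD(9)[OF E])
  qed
  then obtain F'' where F'': "liouville_tower D K E F''" "F' \<subseteq> F''" "\<forall>i\<in>I - {j}. y i / w \<in> F''"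
    using liouville_tower_integrals[OF _ F'(1) K E KE, of "I - {j}" "\<lambda>i. y i / w"] I(1) by blast
  have F''f: "diff_subfield D F''" "K \<subseteq> F''"
    using liouville_tower_subfield[OF F''(1) K E KE] by auto
  have wF'': "w \<in> F''" using wF' F''(2) by blast
  have y_other: "y i \<in> F''" if "i \<in> I - {j}" for i
  proof -
    have "y i / w * w \<in> F''" using that F''(3) wF'' by (intro diff_subfieldD(4)[OF F''f(1)]) auto
    then show ?thesis using w0 by simp
  qed
  have eF'': "e i \<in> F''" if "i \<in> I" for i
    using e(1) that const F''f(2) unfolding constants_def by blast
  \<comment> \<open>The omitted \<open>y j\<close> is recovered from \<open>w\<close> and the other
    solutions, since \<open>e j \<noteq> 0\<close> and the constants \<open>e i\<close> lie in
    \<open>K\<close>.\<close>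
  have "w = e j * y j + (\<Sum>i\<in>I - {j}. e i * y i)"
    unfolding w_def using I(1) e(3) by (rule sum.remove)
  then have "y j = (w - (\<Sum>i\<in>I - {j}. e i * y i)) / e j"
    using e(4) by (simp add: field_simps)
  also have "\<dots> \<in> F''"
    using wF'' eF'' y_other e(3)
    by (intro diff_subfieldD(9)[OF F''f(1)] diff_subfieldD(8)[OF F''f(1)] diff_subfield_sum[OF F''f(1)]
        diff_subfieldD(4)[OF F''f(1)]) auto
  finally have "\<forall>i\<in>I. y i \<in> F''" using y_other by blast
  then show ?case using F'' F'(2) by blast
qed

text \<open>Induction along the tower: Riccati solutions descend field by field to \<open>K\<close>,
  and the field collecting the exponentials grows by at most one generator per step. These are
  always exponentials of integrals over the base \<open>K\<close>.\<close>

lemma admissible_chain: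
  assumes "diff_chain D r Ks" "Ks 0 = K"
    "\<forall>i<r. \<exists>y. special_transcendental D (Ks i) y \<and> Ks (Suc i) = diff_adjoin D (Ks i) y"
  shows "diff_subfield D (Ks r) \<and> K \<subseteq> Ks r \<and> constants D (Ks r) = constants D K \<and>
    (\<forall>n c b. (\<forall>i. c i \<in> K) \<longrightarrow> b \<in> Ks r \<longrightarrow> riccati n c b = 0 \<longrightarrow> (\<exists>b'\<in>K. riccati n c b' = 0)) \<and>
    (\<exists>F. liouville_tower D K (Ks r) F \<and> (\<forall>w\<in>Ks r. exp_integral_over D K w \<longrightarrow> w \<in> F))"
  using assms
proof (induction r)
  case 0
  then show ?case
    by (auto simp: diff_chain_def intro: liouville_tower.base)
next
  case (Suc r)
  then have IH: "diff_subfield D (Ks r)" "K \<subseteq> Ks r" "constants D (Ks r) = constants D K"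
    "\<And>n c b. (\<forall>i. c i \<in> K) \<Longrightarrow> b \<in> Ks r \<Longrightarrow> riccati n c b = 0 \<Longrightarrow> \<exists>b'\<in>K. riccati n c b' = 0"
    and "\<exists>F. liouville_tower D K (Ks r) F \<and> (\<forall>w\<in>Ks r. exp_integral_over D K w \<longrightarrow> w \<in> F)"
    by (auto simp: diff_chain_def)
  then obtain F where F: "liouville_tower D K (Ks r) F" "\<forall>w\<in>Ks r. exp_integral_over D K w \<longrightarrow> w \<in> F"
    by blast
  have base: "diff_subfield D K" using Suc.prems by (auto simp: diff_chain_def)
  obtain y where y: "special_transcendental D (Ks r) y" "Ks (Suc r) = diff_adjoin D (Ks r) y"
    using Suc.prems(3) by blast
  interpret special_extension D "Ks r" y
    using IH(1) y(1) by unfold_locales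
  have ext: "diff_subfield D (Ks (Suc r))" "Ks r \<subseteq> Ks (Suc r)" "constants D (Ks (Suc r)) = constants D (Ks r)"
    using Suc.prems(1) unfolding diff_chain_def diff_extension_def by auto
  have descent: "\<exists>b'\<in>K. riccati n c b' = 0" if "\<forall>i. c i \<in> K" "b \<in> Ks (Suc r)" "riccati n c b = 0" for n c b
    using riccati_descent[of b n c] that IH(2,4) y(2) by blast
  have F_sub: "diff_subfield D F" "K \<subseteq> F" "F \<subseteq> Ks r"
    using liouville_tower_subfield[OF F(1) base IH(1,2)] by auto
  have F_tower: "liouville_tower D K (Ks (Suc r)) F"
    using liouville_tower_mono[OF F(1) ext(2)] .
  consider "\<forall>w\<in>Ks (Suc r). exp_integral_over D K w \<longrightarrow> w \<in> F"
    | v where "v \<in> Ks (Suc r)" "exp_integral_over D K v" "transcendental_over (Ks r) v"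
      "\<forall>w\<in>Ks (Suc r). exp_integral_over D K w \<longrightarrow> w \<in> diff_adjoin D F v"
    using exp_integral_generator[of K F] ext(3) base IH(2) F_sub(1) F(2) unfolding y(2) by blast
  then have "\<exists>F. liouville_tower D K (Ks (Suc r)) F \<and> (\<forall>w\<in>Ks (Suc r). exp_integral_over D K w \<longrightarrow> w \<in> F)"
  proof cases
    case 1
    then show ?thesis using F_tower by blast
  next
    case (2 v)
    have "exp_integral_over D F v" using 2(2) F_sub(2) unfolding exp_integral_over_def by blast
    \<comment> \<open>Transcendence over \<open>Ks r\<close> passes to the subfield
      \<open>F\<close>, to which \<open>v\<close> is actually adjoined.\<close>
    moreover have "transcendental_over F v"
      using 2(3) F_sub(3) unfolding transcendental_over_def polys_over_def by blast
    ultimately show ?thesis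
      using liouville_tower.step[OF F_tower 2(1)] 2(4) by blast
  qed
  then show ?case
    using ext IH(2,3) descent by auto
qed

lemma is_solution_iff_monic_op:
  assumes "\<And>j. j < n \<Longrightarrow> c j = a (n - j)"
  shows "is_solution D n a y \<longleftrightarrow> monic_op n c y = 0"
proof -
  have "(\<Sum>i=1..n. a i * (D ^^ (n - i)) y) = (\<Sum>j<n. c j * (D ^^ j) y)"
    by (rule sum.reindex_bij_witness[of _ "\<lambda>j. n - j" "\<lambda>i. n - i"]) (auto simp: assms)
  then show ?thesis unfolding is_solution_def monic_op_def by simp
qed

end

theorem theorem2p2:
  fixes D :: "'a::field_char_0 \<Rightarrow> 'a" and K :: "'a set" and n :: nat and a :: "nat \<Rightarrow> 'a"
  assumes "derivation D" and "diff_subfield D K"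
    and "n \<ge> 1" and "\<And>i. 1 \<le> i \<Longrightarrow> i \<le> n \<Longrightarrow> a i \<in> K"
    and "\<exists>E. admissible_extension D K E \<and> contains_all_solutions D E n a"
  shows "\<exists>m Ks. diff_chain D m Ks \<and> Ks 0 = K \<and> contains_all_solutions D (Ks m) n a \<and>
           (\<forall>i<m. \<exists>y. Ks (Suc i) = diff_adjoin D (Ks i) y \<and>
              (integral_over D (Ks i) y \<or>
               exp_integral_over D (Ks i) y \<and> transcendental_over (Ks i) y))"
proof -
  interpret differential_field D
    using assms(1) by unfold_locales
  note K = assms(2)
  obtain E where adm: "admissible_extension D K E" and sols: "contains_all_solutions D E n a"
    using assms(5) by blast
  obtain r Ls where "diff_chain D r Ls" "Ls 0 = K" "Ls r = E"
    "\<forall>i<r. \<exists>y. special_transcendental D (Ls i) y \<and> Ls (Suc i) = diff_adjoin D (Ls i) y"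
    using adm unfolding admissible_extension_def by blast
  note chain = admissible_chain[OF this(1,2,4), unfolded this(3)]
  then have E: "diff_subfield D E" "K \<subseteq> E" "constants D E = constants D K"
    and descent: "\<And>n c b. (\<And>i. c i \<in> K) \<Longrightarrow> b \<in> E \<Longrightarrow> riccati n c b = 0 \<Longrightarrow> \<exists>b'\<in>K. riccati n c b' = 0"
    by blast+
  obtain F where F: "liouville_tower D K E F" "\<And>w. w \<in> E \<Longrightarrow> exp_integral_over D K w \<Longrightarrow> w \<in> F"
    using chain by blast
  \<comment> \<open>Coefficients are reindexed by the order of the derivative,
    \<open>j = n - i\<close>; the default 0 puts every \<open>c j\<close> in
    \<open>K\<close>.\<close>
  define c where "c j = (if j < n then a (n - j) else 0)" for j
  have c: "c j \<in> K" for j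
    unfolding c_def using assms(4) diff_subfieldD(1)[OF K] by auto
  obtain y where y: "\<forall>i<n. y i \<in> E \<and> is_solution D n a (y i)"
    "\<forall>c. (\<forall>i<n. c i \<in> constants D E) \<and> (\<Sum>i<n. c i * y i) = 0 \<longrightarrow> (\<forall>i<n. c i = 0)"
    using sols unfolding contains_all_solutions_def by blast
  have "\<exists>F'. liouville_tower D K E F' \<and> F \<subseteq> F' \<and> (\<forall>i\<in>{..<n}. y i \<in> F')"
  proof (rule liouville_tower_solutions[OF K E descent F, where c = c])
    show "const_independent E {..<n} y"
      using y(2) unfolding const_independent_def by auto
    show "y i \<in> E \<and> monic_op n c (y i) = 0" if "i \<in> {..<n}" for i
      using y(1) that is_solution_iff_monic_op[of n c a] by (simp add: c_def)
  qed (auto simp: c)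
  then obtain F' where F': "liouville_tower D K E F'" "\<forall>i<n. y i \<in> F'"
    by auto
  \<comment> \<open>Independence refers to the constants of the ambient field; as these agree, the
    \<open>y i\<close> stay independent in \<open>F'\<close>.\<close>
  have "constants D F' = constants D E"
    using liouville_tower_subfield[OF F'(1) K E(1,2)] E(3) unfolding constants_def by blast
  then have "contains_all_solutions D F' n a"
    unfolding contains_all_solutions_def using y F'(2) by auto
  then show ?thesis
    using liouville_tower_chain[OF F'(1) K E] by blast
qed

end
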